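(* Let $H=(V,E)$ be a hypergraph of degree $2$ with $V=\{v_1,\dots,v_n\}$, $E=\{e_1,\dots,e_m\}$, and maps $i_1,i_2\colon V\to E$ with $i_1(v)\ne i_2(v)$, $v\in i_1(v)\cap i_2(v)$. Then for any $\vec{\alpha}\in\{0,1\}^{n}$ and $\vec{\beta}\in\{0,1\}^{m}$: $\mathcal{T}_H,\mathcal{A}_{\vec{\alpha},\vec{\beta}}\models{\boldsymbol q}_H$ iff $f_H(\vec{\alpha},\vec{\beta})=1$.
   Context: A hypergraph is of degree $2$ if every vertex lies in exactly two hyperedges. For each $e\in E$ take a variable $z_e$ and a unary predicate $A_e$; for each $v\in V$ a binary predicate $R_v$. ${\boldsymbol q}_H=\exists\vec{z}\bigwedge_{v\in V}R_v(z_{i_1(v)},z_{i_2(v)})$ is a Boolean CQ and $\mathcal{T}_H$ is the ontology with, for each $e\in E$, the tgd $\forall x\,\big(A_e(x)\to\exists y\,\big[\bigwedge_{v:\,i_1(v)=e}R_v(y,x)\land\bigwedge_{v:\,i_2(v)=e}R_v(x,y)\big]\big)$. For a constant $a$, $\mathcal{A}_{\vec{\alpha},\vec{\beta}}=\{R_{v_i}(a,a)\mid\vec{\alpha}(v_i)=1\}\cup\{A_{e_j}(a)\mid\vec{\beta}(e_j)=1\}$, where $\vec\alpha(v_i)$ is the $i$th component of $\vec\alpha$ and $\vec\beta(e_j)$ the $j$th component of $\vec\beta$. $\mathcal{T}_H,\mathcal{A}\models{\boldsymbol q}_H$ means ${\boldsymbol q}_H$ holds in every model of $\mathcal{T}_H\cup\mathcal{A}$.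 The hypergraph function is $f_H=\bigvee_{X\subseteq E\text{ independent}}\big(\bigwedge_{v\in V\setminus V_X}p_v\land\bigwedge_{e\in X}p_e\big)$, where $X$ is independent if its members are pairwise disjoint and $V_X$ is the set of vertices of hyperedges in $X$; $f_H(\vec\alpha,\vec\beta)$ evaluates it with $p_v:=\vec\alpha(v)$ and $p_e:=\vec\beta(e)$. *)

theory Defs
  imports "HOL-Library.FuncSet" "HOL-Library.Infinite_Typeclass"
begin

datatype ('u, 'b, 't) atom = Unary 'u 't | Binary 'b 't 't

record ('d, 'c, 'u, 'b) fo_structure =
  universe :: "'d set"
  const_of :: "'c \<Rightarrow> 'd"
  unary_of :: "'u \<Rightarrow> 'd set"
  binary_of :: "'b \<Rightarrow> ('d \<times> 'd) set"

definition wf_structure :: "('d, 'c, 'u, 'b) fo_structure \<Rightarrow> bool" where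
  "wf_structure I \<longleftrightarrow>
     universe I \<noteq> {} \<and>
     (\<forall>c. const_of I c \<in> universe I) \<and>
     (\<forall>P. unary_of I P \<subseteq> universe I) \<and>
     (\<forall>P. binary_of I P \<subseteq> universe I \<times> universe I)"

fun sat_atom :: "('d, 'c, 'u, 'b) fo_structure \<Rightarrow> ('t \<Rightarrow> 'd) \<Rightarrow> ('u, 'b, 't) atom \<Rightarrow> bool" where
  "sat_atom I h (Unary P t) \<longleftrightarrow> h t \<in> unary_of I P"
| "sat_atom I h (Binary P s t) \<longleftrightarrow> (h s, h t) \<in> binary_of I P"

record ('u, 'b, 'x) boolean_cq =
  cq_vars :: "'x set"
  cq_atoms :: "('u, 'b, 'x) atom set"

definition sat_cq :: "('d, 'c, 'u, 'b) fo_structure \<Rightarrow> ('u, 'b, 'x) boolean_cq \<Rightarrow> bool" where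
  "sat_cq I q \<longleftrightarrow>
     (\<exists>h. (\<forall>z\<in>cq_vars q. h z \<in> universe I) \<and> (\<forall>\<phi>\<in>cq_atoms q. sat_atom I h \<phi>))"

record ('u, 'b, 'x) tgd =
  univ_vars :: "'x set"
  body :: "('u, 'b, 'x) atom set"
  ex_vars :: "'x set"
  head :: "('u, 'b, 'x) atom set"

definition sat_tgd :: "('d, 'c, 'u, 'b) fo_structure \<Rightarrow> ('u, 'b, 'x) tgd \<Rightarrow> bool" where
  "sat_tgd I \<tau> \<longleftrightarrow>
     (\<forall>h. (\<forall>x\<in>univ_vars \<tau>. h x \<in> universe I) \<and> (\<forall>\<phi>\<in>body \<tau>. sat_atom I h \<phi>) \<longrightarrow>
       (\<exists>h'. (\<forall>x\<in>univ_vars \<tau>. h' x = h x) \<and> (\<forall>y\<in>ex_vars \<tau>. h' y \<in> universe I) \<and>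
         (\<forall>\<phi>\<in>head \<tau>. sat_atom I h' \<phi>)))"

definition is_model ::
    "('d, 'c, 'u, 'b) fo_structure \<Rightarrow> ('u, 'b, 'x) tgd set \<Rightarrow> ('u, 'b, 'c) atom set \<Rightarrow> bool" where
  "is_model I T A \<longleftrightarrow>
     wf_structure I \<and> (\<forall>\<tau>\<in>T. sat_tgd I \<tau>) \<and> (\<forall>\<phi>\<in>A. sat_atom I (const_of I) \<phi>)"

text \<open>
  HOL cannot quantify over types inside a formula, so the universes of the models are the
  nonempty subsets of a type \<open>'d\<close>, given as a parameter. Results about entailment are
  polymorphic in \<open>'d\<close>, hence cover models of every cardinality. The type has to be infinite,
  since a finite one would exclude all but the small models.
\<close>

definition entails ::
    "'d::infinite itself \<Rightarrow> ('u, 'b, 'x) tgd set \<Rightarrow> ('u, 'b, 'c) atom set \<Rightarrow>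
     ('u, 'b, 'z) boolean_cq \<Rightarrow> bool" where
  "entails _ T A q \<longleftrightarrow>
     (\<forall>I :: ('d, 'c, 'u, 'b) fo_structure. is_model I T A \<longrightarrow> sat_cq I q)"

definition hypergraph :: "'v set \<Rightarrow> 'v set set \<Rightarrow> bool" where
  "hypergraph V E \<longleftrightarrow> finite V \<and> E \<subseteq> Pow V"

definition degree_2 :: "'v set \<Rightarrow> 'v set set \<Rightarrow> bool" where
  "degree_2 V E \<longleftrightarrow> (\<forall>v\<in>V. card {e \<in> E. v \<in> e} = 2)"

definition independent_edges :: "'v set set \<Rightarrow> bool" where
  "independent_edges X \<longleftrightarrow> pairwise disjnt X"

definition hypergraph_function ::
    "'v set \<Rightarrow> 'v set set \<Rightarrow> ('v \<Rightarrow> bool) \<Rightarrow> ('v set \<Rightarrow> bool) \<Rightarrow> bool" where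
  "hypergraph_function V E p\<^sub>V p\<^sub>E \<longleftrightarrow>
     (\<exists>X\<subseteq>E. independent_edges X \<and> (\<forall>v\<in>V - \<Union>X. p\<^sub>V v) \<and> (\<forall>e\<in>X. p\<^sub>E e))"

text \<open>
  The predicates $A_e$ and $R_v$ are \<open>Unary e\<close> and \<open>Binary v\<close>, and the query variable
  $z_e$ is the hyperedge \<open>e\<close> itself.
\<close>

definition query_of ::
    "'v set \<Rightarrow> 'v set set \<Rightarrow> ('v \<Rightarrow> 'v set) \<Rightarrow> ('v \<Rightarrow> 'v set) \<Rightarrow>
     ('v set, 'v, 'v set) boolean_cq" where
  "query_of V E i\<^sub>1 i\<^sub>2 = \<lparr>cq_vars = E, cq_atoms = {Binary v (i\<^sub>1 v) (i\<^sub>2 v) | v. v \<in> V}\<rparr>"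

datatype tgd_var = VarX | VarY

definition tgd_of ::
    "'v set \<Rightarrow> ('v \<Rightarrow> 'v set) \<Rightarrow> ('v \<Rightarrow> 'v set) \<Rightarrow> 'v set \<Rightarrow> ('v set, 'v, tgd_var) tgd" where
  "tgd_of V i\<^sub>1 i\<^sub>2 e =
     \<lparr>univ_vars = {VarX},
      body = {Unary e VarX},
      ex_vars = {VarY},
      head = {Binary v VarY VarX | v. v \<in> V \<and> i\<^sub>1 v = e} \<union>
             {Binary v VarX VarY | v. v \<in> V \<and> i\<^sub>2 v = e}\<rparr>"

definition ontology_of ::
    "'v set \<Rightarrow> 'v set set \<Rightarrow> ('v \<Rightarrow> 'v set) \<Rightarrow> ('v \<Rightarrow> 'v set) \<Rightarrow>
     ('v set, 'v, tgd_var) tgd set" where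
  "ontology_of V E i\<^sub>1 i\<^sub>2 = tgd_of V i\<^sub>1 i\<^sub>2 ` E"

text \<open>
  The component of the 0/1-vector \<open>bs\<close> at the position where the enumeration \<open>xs\<close> lists
  \<open>x\<close>; meaningful for distinct \<open>xs\<close> containing \<open>x\<close> and \<open>bs\<close> of the same length.
\<close>

definition component :: "'a list \<Rightarrow> bool list \<Rightarrow> 'a \<Rightarrow> bool" where
  "component xs bs x = the (map_of (zip xs bs) x)"

definition abox_of ::
    "'v set \<Rightarrow> 'v set set \<Rightarrow> 'c \<Rightarrow> ('v \<Rightarrow> bool) \<Rightarrow> ('v set \<Rightarrow> bool) \<Rightarrow> ('v set, 'v, 'c) atom set" where
  "abox_of V E a p\<^sub>V p\<^sub>E =
     {Binary v a a | v. v \<in> V \<and> p\<^sub>V v} \<union> {Unary e a | e. e \<in> E \<and> p\<^sub>E e}"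

end

theory Submission imports Defs begin

text \<open>
  Dually, a hypergraph of degree 2 is a graph whose nodes are the hyperedges, each vertex \<open>v\<close>
  joining \<open>i\<^sub>1 v\<close> to \<open>i\<^sub>2 v\<close>; independent sets of hyperedges are independent sets of nodes.
  Such a set \<open>X\<close> yields a match of the query in any model: send \<open>z\<^sub>e\<close> to the witness supplied
  by the tgd of \<open>e\<close> if \<open>e \<in> X\<close>, and to \<open>a\<close> otherwise, so that every query atom has an endpoint
  at \<open>a\<close>. For the converse a model with just two elements suffices, the constant and a single
  witness shared by all the tgds: no \<open>R\<^sub>v\<close> relates the witness to itself, so the hyperedges \<open>e\<close>
  with \<open>A\<^sub>e(a)\<close> in the data and \<open>z\<^sub>e\<close> matched to the witness are independent.
\<close>

definition tgd_witness ::
    "('d, 'c, 'v set, 'v) fo_structure \<Rightarrow> 'v set \<Rightarrow> ('v \<Rightarrow> 'v set) \<Rightarrow> ('v \<Rightarrow> 'v set) \<Rightarrow>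
     'v set \<Rightarrow> 'd \<Rightarrow> 'd \<Rightarrow> bool" where
  "tgd_witness I V i\<^sub>1 i\<^sub>2 e x y \<longleftrightarrow>
     y \<in> universe I \<and>
     (\<forall>v\<in>V. i\<^sub>1 v = e \<longrightarrow> (y, x) \<in> binary_of I v) \<and>
     (\<forall>v\<in>V. i\<^sub>2 v = e \<longrightarrow> (x, y) \<in> binary_of I v)"

lemma sat_head_tgd_of_iff:
  "(\<forall>y\<in>ex_vars (tgd_of V i\<^sub>1 i\<^sub>2 e). h y \<in> universe I) \<and>
   (\<forall>\<phi>\<in>head (tgd_of V i\<^sub>1 i\<^sub>2 e). sat_atom I h \<phi>) \<longleftrightarrow>
     tgd_witness I V i\<^sub>1 i\<^sub>2 e (h VarX) (h VarY)"
  unfolding tgd_of_def tgd_witness_def by (simp add: ball_Un) (auto 0 3)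

lemma sat_tgd_tgd_of_iff:
  "sat_tgd I (tgd_of V i\<^sub>1 i\<^sub>2 e) \<longleftrightarrow>
     (\<forall>x \<in> universe I \<inter> unary_of I e. \<exists>y. tgd_witness I V i\<^sub>1 i\<^sub>2 e x y)"
proof -
  have "sat_tgd I (tgd_of V i\<^sub>1 i\<^sub>2 e) \<longleftrightarrow>
     (\<forall>h. h VarX \<in> universe I \<inter> unary_of I e \<longrightarrow>
       (\<exists>h'. h' VarX = h VarX \<and> tgd_witness I V i\<^sub>1 i\<^sub>2 e (h' VarX) (h' VarY)))"
    unfolding sat_tgd_def sat_head_tgd_of_iff by (simp add: tgd_of_def)
  also have "\<dots> \<longleftrightarrow>
     (\<forall>h. h VarX \<in> universe I \<inter> unary_of I e \<longrightarrow> (\<exists>y. tgd_witness I V i\<^sub>1 i\<^sub>2 e (h VarX) y))"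
    by (metis fun_upd_other fun_upd_same tgd_var.distinct(1))
  also have "\<dots> \<longleftrightarrow> (\<forall>x \<in> universe I \<inter> unary_of I e. \<exists>y. tgd_witness I V i\<^sub>1 i\<^sub>2 e x y)"
    by (metis fun_upd_same)
  finally show ?thesis .
qed

lemma sat_abox_of_iff:
  "(\<forall>\<phi>\<in>abox_of V E a p\<^sub>V p\<^sub>E. sat_atom I h \<phi>) \<longleftrightarrow>
     (\<forall>v\<in>V. p\<^sub>V v \<longrightarrow> (h a, h a) \<in> binary_of I v) \<and> (\<forall>e\<in>E. p\<^sub>E e \<longrightarrow> h a \<in> unary_of I e)"
  unfolding abox_of_def ball_Un by (intro conj_cong) auto

lemma is_model_ontology_of_abox_of_iff:
  "is_model I (ontology_of V E i\<^sub>1 i\<^sub>2) (abox_of V E a p\<^sub>V p\<^sub>E) \<longleftrightarrow>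
     wf_structure I \<and>
     (\<forall>e\<in>E. \<forall>x \<in> universe I \<inter> unary_of I e. \<exists>y. tgd_witness I V i\<^sub>1 i\<^sub>2 e x y) \<and>
     (\<forall>v\<in>V. p\<^sub>V v \<longrightarrow> (const_of I a, const_of I a) \<in> binary_of I v) \<and>
     (\<forall>e\<in>E. p\<^sub>E e \<longrightarrow> const_of I a \<in> unary_of I e)"
  by (simp add: is_model_def ontology_of_def sat_tgd_tgd_of_iff sat_abox_of_iff)

lemma sat_cq_query_of_iff:
  "sat_cq I (query_of V E i\<^sub>1 i\<^sub>2) \<longleftrightarrow>
     (\<exists>h. (\<forall>e\<in>E. h e \<in> universe I) \<and> (\<forall>v\<in>V. (h (i\<^sub>1 v), h (i\<^sub>2 v)) \<in> binary_of I v))"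
  unfolding sat_cq_def query_of_def by (intro ex_cong1) auto

lemma sat_cq_query_of_if_tgd_witnesses:
  assumes "d \<in> universe I"
    and witnesses: "\<And>e. e \<in> X \<Longrightarrow> \<exists>y. tgd_witness I V i\<^sub>1 i\<^sub>2 e d y"
    and independent: "\<And>v. v \<in> V \<Longrightarrow> \<not> (i\<^sub>1 v \<in> X \<and> i\<^sub>2 v \<in> X)"
    and loops: "\<And>v. v \<in> V \<Longrightarrow> i\<^sub>1 v \<in> X \<or> i\<^sub>2 v \<in> X \<or> (d, d) \<in> binary_of I v"
  shows "sat_cq I (query_of V E i\<^sub>1 i\<^sub>2)"
proof -
  obtain w where w: "tgd_witness I V i\<^sub>1 i\<^sub>2 e d (w e)" if "e \<in> X" for e
    using witnesses by metis
  define h where "h e = (if e \<in> X then w e else d)" for e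
  have "h e \<in> universe I" for e
    using w \<open>d \<in> universe I\<close> by (simp add: h_def tgd_witness_def)
  moreover have "(h (i\<^sub>1 v), h (i\<^sub>2 v)) \<in> binary_of I v" if "v \<in> V" for v
    using independent[OF that] loops[OF that] w[of "i\<^sub>1 v"] w[of "i\<^sub>2 v"] that
    by (auto simp: h_def tgd_witness_def)
  ultimately show ?thesis
    unfolding sat_cq_query_of_iff by blast
qed

definition two_element_model ::
    "'d \<Rightarrow> 'd \<Rightarrow> ('v \<Rightarrow> 'v set) \<Rightarrow> ('v \<Rightarrow> 'v set) \<Rightarrow> ('v \<Rightarrow> bool) \<Rightarrow> ('v set \<Rightarrow> bool) \<Rightarrow>
     ('d, 'c, 'v set, 'v) fo_structure" where
  "two_element_model d w i\<^sub>1 i\<^sub>2 p\<^sub>V p\<^sub>E =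
     \<lparr>universe = {d, w},
      const_of = (\<lambda>_. d),
      unary_of = (\<lambda>e. {x. x = d \<and> p\<^sub>E e}),
      binary_of = (\<lambda>v. {(x, y). x = d \<and> y = d \<and> p\<^sub>V v \<or>
                               x = w \<and> y = d \<and> p\<^sub>E (i\<^sub>1 v) \<or>
                               x = d \<and> y = w \<and> p\<^sub>E (i\<^sub>2 v)})\<rparr>"

lemma is_model_two_element_model:
  "is_model (two_element_model d w i\<^sub>1 i\<^sub>2 p\<^sub>V p\<^sub>E)
     (ontology_of V E i\<^sub>1 i\<^sub>2) (abox_of V E a p\<^sub>V p\<^sub>E)"
proof -
  let ?I = "two_element_model d w i\<^sub>1 i\<^sub>2 p\<^sub>V p\<^sub>E"
  have "wf_structure ?I"
    by (auto simp: wf_structure_def two_element_model_def)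
  moreover have "tgd_witness ?I V i\<^sub>1 i\<^sub>2 e x w" if "x \<in> unary_of ?I e" for e x
    using that by (auto simp: tgd_witness_def two_element_model_def)
  moreover have "(const_of ?I a, const_of ?I a) \<in> binary_of ?I v" if "p\<^sub>V v" for v
    using that by (simp add: two_element_model_def)
  moreover have "const_of ?I a \<in> unary_of ?I e" if "p\<^sub>E e" for e
    using that by (simp add: two_element_model_def)
  ultimately show ?thesis
    unfolding is_model_ontology_of_abox_of_iff by blast
qed

locale degree_2_hypergraph =
  fixes V :: "'v set" and E :: "'v set set" and i\<^sub>1 i\<^sub>2 :: "'v \<Rightarrow> 'v set"
  assumes edges_subset: "E \<subseteq> Pow V"
    and degree: "degree_2 V E"
    and endpoints_in_edges: "i\<^sub>1 \<in> V \<rightarrow> E" "i\<^sub>2 \<in> V \<rightarrow> E"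
    and endpoints_distinct: "v \<in> V \<Longrightarrow> i\<^sub>1 v \<noteq> i\<^sub>2 v"
    and mem_endpoints: "v \<in> V \<Longrightarrow> v \<in> i\<^sub>1 v \<inter> i\<^sub>2 v"
begin

lemma mem_edge_iff:
  assumes "v \<in> V" and "e \<in> E"
  shows "v \<in> e \<longleftrightarrow> e = i\<^sub>1 v \<or> e = i\<^sub>2 v"
proof -
  have "card {e \<in> E. v \<in> e} = 2"
    using degree \<open>v \<in> V\<close> by (simp add: degree_2_def)
  moreover have "{i\<^sub>1 v, i\<^sub>2 v} \<subseteq> {e \<in> E. v \<in> e}"
    using endpoints_in_edges mem_endpoints \<open>v \<in> V\<close> by auto
  moreover have "card {i\<^sub>1 v, i\<^sub>2 v} = 2"
    using endpoints_distinct \<open>v \<in> V\<close> by simp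
  ultimately have "{i\<^sub>1 v, i\<^sub>2 v} = {e \<in> E. v \<in> e}"
    by (metis card.infinite card_subset_eq zero_neq_numeral)
  then show ?thesis
    using \<open>e \<in> E\<close> by blast
qed

lemma mem_Union_edges_iff:
  assumes "X \<subseteq> E" and "v \<in> V"
  shows "v \<in> \<Union>X \<longleftrightarrow> i\<^sub>1 v \<in> X \<or> i\<^sub>2 v \<in> X"
proof -
  have "v \<in> \<Union>X \<longleftrightarrow> (\<exists>e\<in>X. e = i\<^sub>1 v \<or> e = i\<^sub>2 v)"
    unfolding Union_iff using assms by (intro bex_cong refl mem_edge_iff) auto
  then show ?thesis
    by blast
qed

lemma independent_edges_iff:
  assumes "X \<subseteq> E"
  shows "independent_edges X \<longleftrightarrow> (\<forall>v\<in>V. \<not> (i\<^sub>1 v \<in> X \<and> i\<^sub>2 v \<in> X))"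
proof
  assume "independent_edges X"
  then have "e = e'" if "e \<in> X" "e' \<in> X" "v \<in> e \<inter> e'" for e e' v
    using that by (auto simp: independent_edges_def pairwise_def disjnt_iff)
  then show "\<forall>v\<in>V. \<not> (i\<^sub>1 v \<in> X \<and> i\<^sub>2 v \<in> X)"
    using endpoints_distinct mem_endpoints by metis
next
  assume endpoints: "\<forall>v\<in>V. \<not> (i\<^sub>1 v \<in> X \<and> i\<^sub>2 v \<in> X)"
  have "e = e'" if "e \<in> X" "e' \<in> X" "v \<in> e" "v \<in> e'" for e e' v
  proof -
    have "v \<in> V" "e \<in> E" "e' \<in> E"
      using that assms edges_subset by auto
    then have "e = i\<^sub>1 v \<or> e = i\<^sub>2 v" "e' = i\<^sub>1 v \<or> e' = i\<^sub>2 v"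
      using that mem_edge_iff by auto
    then show ?thesis
      using endpoints \<open>v \<in> V\<close> that by metis
  qed
  then show "independent_edges X"
    by (auto simp: independent_edges_def pairwise_def disjnt_iff)
qed

lemma hypergraph_function_iff:
  "hypergraph_function V E p\<^sub>V p\<^sub>E \<longleftrightarrow>
     (\<exists>X\<subseteq>E. (\<forall>v\<in>V. \<not> (i\<^sub>1 v \<in> X \<and> i\<^sub>2 v \<in> X)) \<and>
        (\<forall>v\<in>V. i\<^sub>1 v \<in> X \<or> i\<^sub>2 v \<in> X \<or> p\<^sub>V v) \<and> (\<forall>e\<in>X. p\<^sub>E e))"
proof -
  have uncovered: "(\<forall>v\<in>V - \<Union>X. p\<^sub>V v) \<longleftrightarrow> (\<forall>v\<in>V. i\<^sub>1 v \<in> X \<or> i\<^sub>2 v \<in> X \<or> p\<^sub>V v)"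
    if "X \<subseteq> E" for X
    using mem_Union_edges_iff[OF that] by (metis Diff_iff)
  show ?thesis
    unfolding hypergraph_function_def
    by (intro ex_cong1 conj_cong refl independent_edges_iff uncovered)
qed

lemma sat_cq_query_of_if_hypergraph_function:
  assumes model: "is_model I (ontology_of V E i\<^sub>1 i\<^sub>2) (abox_of V E a p\<^sub>V p\<^sub>E)"
    and "hypergraph_function V E p\<^sub>V p\<^sub>E"
  shows "sat_cq I (query_of V E i\<^sub>1 i\<^sub>2)"
proof -
  obtain X where "X \<subseteq> E" and labelled: "\<And>e. e \<in> X \<Longrightarrow> p\<^sub>E e"
    and independent: "\<And>v. v \<in> V \<Longrightarrow> \<not> (i\<^sub>1 v \<in> X \<and> i\<^sub>2 v \<in> X)"
    and covered: "\<And>v. v \<in> V \<Longrightarrow> i\<^sub>1 v \<in> X \<or> i\<^sub>2 v \<in> X \<or> p\<^sub>V v"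
    using assms(2) unfolding hypergraph_function_iff by blast
  show ?thesis
  proof (rule sat_cq_query_of_if_tgd_witnesses)
    show const_in_universe: "const_of I a \<in> universe I"
      using model by (simp add: is_model_def wf_structure_def)
    show "\<exists>y. tgd_witness I V i\<^sub>1 i\<^sub>2 e (const_of I a) y" if "e \<in> X" for e
      using model const_in_universe labelled[OF that] \<open>X \<subseteq> E\<close> that
      unfolding is_model_ontology_of_abox_of_iff by blast
    show "i\<^sub>1 v \<in> X \<or> i\<^sub>2 v \<in> X \<or> (const_of I a, const_of I a) \<in> binary_of I v"
      if "v \<in> V" for v
      using model covered[OF that] that unfolding is_model_ontology_of_abox_of_iff by blast
  qed (fact independent)
qed

lemma hypergraph_function_if_sat_cq_two_element_model:
  assumes "d \<noteq> w"
    and "sat_cq (two_element_model d w i\<^sub>1 i\<^sub>2 p\<^sub>V p\<^sub>E) (query_of V E i\<^sub>1 i\<^sub>2)"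
  shows "hypergraph_function V E p\<^sub>V p\<^sub>E"
proof -
  obtain h where match: "h (i\<^sub>1 v) = d \<and> h (i\<^sub>2 v) = d \<and> p\<^sub>V v \<or>
      h (i\<^sub>1 v) = w \<and> h (i\<^sub>2 v) = d \<and> p\<^sub>E (i\<^sub>1 v) \<or>
      h (i\<^sub>1 v) = d \<and> h (i\<^sub>2 v) = w \<and> p\<^sub>E (i\<^sub>2 v)" if "v \<in> V" for v
    using assms(2) unfolding sat_cq_query_of_iff by (auto simp: two_element_model_def)
  \<comment> \<open>An empty hyperedge occurs in no query atom, so \<open>h e = w\<close> alone does not give \<open>p\<^sub>E e\<close>.\<close>
  define X where "X = {e \<in> E. h e = w \<and> p\<^sub>E e}"
  have "\<not> (i\<^sub>1 v \<in> X \<and> i\<^sub>2 v \<in> X)" if "v \<in> V" for v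
    using match[OF that] \<open>d \<noteq> w\<close> by (auto simp: X_def)
  moreover have "i\<^sub>1 v \<in> X \<or> i\<^sub>2 v \<in> X \<or> p\<^sub>V v" if "v \<in> V" for v
    using match[OF that] endpoints_in_edges that by (auto simp: X_def)
  moreover have "X \<subseteq> E" and "\<forall>e\<in>X. p\<^sub>E e"
    by (auto simp: X_def)
  ultimately show ?thesis
    unfolding hypergraph_function_iff by blast
qed

end

theorem theorem11:
  fixes V :: "'v set" and E :: "'v set set"
    and vs :: "'v list" and es :: "'v set list"
    and i\<^sub>1 i\<^sub>2 :: "'v \<Rightarrow> 'v set"
    and \<alpha> \<beta> :: "bool list"
    and n m :: nat
    and a :: 'c
  assumes "hypergraph V E" and "degree_2 V E"
    and "set vs = V" and "distinct vs" and "length vs = n"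
    and "set es = E" and "distinct es" and "length es = m"
    and "i\<^sub>1 \<in> V \<rightarrow> E" and "i\<^sub>2 \<in> V \<rightarrow> E"
    and "\<And>v. v \<in> V \<Longrightarrow> i\<^sub>1 v \<noteq> i\<^sub>2 v"
    and "\<And>v. v \<in> V \<Longrightarrow> v \<in> i\<^sub>1 v \<inter> i\<^sub>2 v"
    and "length \<alpha> = n" and "length \<beta> = m"
  shows "entails TYPE('d::infinite) (ontology_of V E i\<^sub>1 i\<^sub>2)
           (abox_of V E a (component vs \<alpha>) (component es \<beta>)) (query_of V E i\<^sub>1 i\<^sub>2)
         \<longleftrightarrow> hypergraph_function V E (component vs \<alpha>) (component es \<beta>)"
proof -
  interpret degree_2_hypergraph V E i\<^sub>1 i\<^sub>2
    using assms by unfold_locales (auto simp: hypergraph_def)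
  show ?thesis
  proof
    assume entails: "entails TYPE('d) (ontology_of V E i\<^sub>1 i\<^sub>2)
      (abox_of V E a (component vs \<alpha>) (component es \<beta>)) (query_of V E i\<^sub>1 i\<^sub>2)"
    obtain d w :: 'd where "d \<noteq> w"
      using ex_new_if_finite[OF infinite_UNIV, of "{undefined :: 'd}"] by auto
    have "sat_cq (two_element_model d w i\<^sub>1 i\<^sub>2 (component vs \<alpha>) (component es \<beta>) ::
        ('d, 'c, 'v set, 'v) fo_structure) (query_of V E i\<^sub>1 i\<^sub>2)"
      using entails by (simp add: entails_def is_model_two_element_model)
    with \<open>d \<noteq> w\<close> show "hypergraph_function V E (component vs \<alpha>) (component es \<beta>)"
      by (rule hypergraph_function_if_sat_cq_two_element_model)
  next
    assume "hypergraph_function V E (component vs \<alpha>) (component es \<beta>)"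
    then show "entails TYPE('d) (ontology_of V E i\<^sub>1 i\<^sub>2)
        (abox_of V E a (component vs \<alpha>) (component es \<beta>)) (query_of V E i\<^sub>1 i\<^sub>2)"
      unfolding entails_def by (blast intro: sat_cq_query_of_if_hypergraph_function)
  qed
qed

end
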